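(* Let $0\le\lambda<1$, and let $\mathrm{iid}(\pm1)$ be the i.i.d. Rademacher prior. Then $\mathrm{GWig}_n(\lambda,\mathrm{iid}(\pm1))$ is contiguous to $\mathrm{GWig}_n(0)$.
   Context: $\mathrm{iid}(\pm1)$ is the family of distributions $\{\mathcal{X}_n\}$ in which the coordinates of $x\in\mathbb{R}^n$ are independent and uniform on $\{+1/\sqrt n,-1/\sqrt n\}$. For $\lambda\ge0$, $\mathrm{GWig}_n(\lambda,\mathcal{X})$ is the law of the $n\times n$ matrix $Y=\lambda xx^\top+\frac{1}{\sqrt n}W$, where $x\sim\mathcal{X}_n$ and, independently of $x$, $W$ is an $n\times n$ GOE matrix: random symmetric, off-diagonal entries $\mathcal{N}(0,1)$, diagonal entries $\mathcal{N}(0,2)$, all entries independent except for $W_{ij}=W_{ji}$. $\mathrm{GWig}_n(0)$ denotes the case $\lambda=0$. Contiguity: for sequences of probability measures $P_n,Q_n$ on measurable spaces $(\Omega_n,\mathcal{F}_n)$, $P_n$ is contiguous to $Q_n$ if for every sequence of events $A_n\in\mathcal{F}_n$, $Q_n(A_n)\to0$ implies $P_n(A_n)\to0$ as $n\to\infty$. *)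

theory Defs
  imports "HOL-Probability.Probability"
begin

text \<open>
  Since the dimension \<open>n\<close> tends to infinity, vectors in \<open>\<real>\<^sup>n\<close> and real \<open>n \<times> n\<close> matrices are
  extensional functions on \<open>{..<n}\<close> and \<open>{..<n} \<times> {..<n}\<close>, with the product Borel
  sigma-algebra. The entries of a matrix \<open>Y\<close> are \<open>Y (i, j)\<close>, indexed from \<open>0\<close>.
\<close>

definition vec_space :: "nat \<Rightarrow> (nat \<Rightarrow> real) measure" where
  "vec_space n = (\<Pi>\<^sub>M i\<in>{..<n}. borel)"

definition mat_space :: "nat \<Rightarrow> (nat \<times> nat \<Rightarrow> real) measure" where
  "mat_space n = (\<Pi>\<^sub>M ij\<in>{..<n} \<times> {..<n}. borel)"

text \<open>
  The entries \<open>W\<^sub>i\<^sub>j\<close> with \<open>i \<le> j\<close> are drawn independently and copied to the lower triangle.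
  The second parameter of \<^const>\<open>normal_density\<close> is the standard deviation, hence \<open>sqrt 2\<close> for the
  diagonal entries, which are \<open>N(0, 2)\<close>.
\<close>

definition goe_upper :: "nat \<Rightarrow> (nat \<times> nat \<Rightarrow> real) measure" where
  "goe_upper n = (\<Pi>\<^sub>M ij\<in>{(i, j). i \<le> j \<and> j < n}.
     density lborel (normal_density 0 (if fst ij = snd ij then sqrt 2 else 1)))"

definition GOE :: "nat \<Rightarrow> (nat \<times> nat \<Rightarrow> real) measure" where
  "GOE n = distr (goe_upper n) (mat_space n)
     (\<lambda>g. \<lambda>(i, j)\<in>{..<n} \<times> {..<n}. g (min i j, max i j))"

text \<open>A spike prior is a family of distributions, the \<open>n\<close>-th one on \<^term>\<open>vec_space n\<close>.\<close>

definition iid_pm1 :: "nat \<Rightarrow> (nat \<Rightarrow> real) measure" where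
  "iid_pm1 n = (\<Pi>\<^sub>M i\<in>{..<n}.
     distr (measure_pmf (pmf_of_set {1 / sqrt (real n), - 1 / sqrt (real n)})) borel (\<lambda>t. t))"

text \<open>The product measure in \<open>GWig\<close> expresses the independence of \<open>x\<close> and \<open>W\<close>.\<close>

definition GWig :: "nat \<Rightarrow> real \<Rightarrow> (nat \<Rightarrow> (nat \<Rightarrow> real) measure) \<Rightarrow> (nat \<times> nat \<Rightarrow> real) measure" where
  "GWig n lam X = distr (X n \<Otimes>\<^sub>M GOE n) (mat_space n)
     (\<lambda>(x, W). \<lambda>(i, j)\<in>{..<n} \<times> {..<n}. lam * (x i * x j) + 1 / sqrt (real n) * W (i, j))"

text \<open>
  The prior in the next definition is irrelevant, as shown by the lemma \<open>GWig_zero\<close> below.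
\<close>

definition GWig_null :: "nat \<Rightarrow> (nat \<times> nat \<Rightarrow> real) measure" where
  "GWig_null n = GWig n 0 iid_pm1"

text \<open>
  Contiguity of \<open>P\<close> to \<open>Q\<close>. The requirement that \<open>P n\<close> and \<open>Q n\<close> are probability measures on a
  common measurable space is part of the definition.
\<close>

definition contiguous :: "(nat \<Rightarrow> 'a measure) \<Rightarrow> (nat \<Rightarrow> 'a measure) \<Rightarrow> bool" where
  "contiguous P Q \<longleftrightarrow>
     (\<forall>n. prob_space (P n) \<and> prob_space (Q n) \<and> sets (P n) = sets (Q n)) \<and>
     (\<forall>A. (\<forall>n. A n \<in> sets (Q n)) \<longrightarrow>
        (\<lambda>n. measure (Q n) (A n)) \<longlonglongrightarrow> 0 \<longrightarrow> (\<lambda>n. measure (P n) (A n)) \<longlonglongrightarrow> 0)"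

lemma prob_space_goe_upper: "prob_space (goe_upper n)"
  unfolding goe_upper_def by (intro prob_space_PiM prob_space_normal_density) auto

lemma measurable_goe_symmetrize:
  "(\<lambda>g. \<lambda>(i, j)\<in>{..<n} \<times> {..<n}. g (min i j, max i j)) \<in> goe_upper n \<rightarrow>\<^sub>M mat_space n"
proof -
  have sets: "sets (goe_upper n) = sets (\<Pi>\<^sub>M ij\<in>{(i, j). i \<le> j \<and> j < n}. (borel :: real measure))"
    unfolding goe_upper_def by (intro sets_PiM_cong) simp_all
  have "(\<lambda>g. g (min i j, max i j)) \<in> borel_measurable (goe_upper n)" if "i < n" "j < n" for i j
    unfolding measurable_cong_sets[OF sets refl]
    by (intro measurable_component_singleton) (use that in simp)
  then show ?thesis
    unfolding mat_space_def by (intro measurable_restrict) auto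
qed

lemma prob_space_GOE: "prob_space (GOE n)"
  unfolding GOE_def
  by (intro prob_space.prob_space_distr prob_space_goe_upper measurable_goe_symmetrize)

lemma sets_GOE: "sets (GOE n) = sets (mat_space n)"
  by (simp add: GOE_def)

lemma prob_space_iid_pm1: "prob_space (iid_pm1 n)"
  unfolding iid_pm1_def
  by (intro prob_space_PiM prob_space.prob_space_distr measure_pmf.prob_space_axioms) auto

lemma sets_iid_pm1: "sets (iid_pm1 n) = sets (vec_space n)"
  unfolding iid_pm1_def vec_space_def by (intro sets_PiM_cong) auto

lemma measurable_GWig:
  assumes "sets (X n) = sets (vec_space n)"
  shows "(\<lambda>(x, W). \<lambda>(i, j)\<in>{..<n} \<times> {..<n}. lam * (x i * x j) + 1 / sqrt (real n) * W (i, j))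
    \<in> X n \<Otimes>\<^sub>M GOE n \<rightarrow>\<^sub>M mat_space n"
proof -
  have eq: "sets (X n \<Otimes>\<^sub>M GOE n) = sets (vec_space n \<Otimes>\<^sub>M mat_space n)"
    by (intro sets_pair_measure_cong assms sets_GOE)
  have "(\<lambda>p. lam * (fst p i * fst p j) + 1 / sqrt (real n) * snd p (i, j))
      \<in> borel_measurable (vec_space n \<Otimes>\<^sub>M mat_space n)" if "i < n" "j < n" for i j
  proof -
    have x: "(\<lambda>p. fst p k) \<in> borel_measurable (vec_space n \<Otimes>\<^sub>M mat_space n)" if "k < n" for k
      using that unfolding vec_space_def
      by (intro measurable_compose[OF measurable_fst] measurable_component_singleton) auto
    have W: "(\<lambda>p. snd p (i, j)) \<in> borel_measurable (vec_space n \<Otimes>\<^sub>M mat_space n)"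
      using that unfolding mat_space_def
      by (intro measurable_compose[OF measurable_snd] measurable_component_singleton) auto
    show ?thesis
      using x[OF that(1)] x[OF that(2)] W by measurable
  qed
  then show ?thesis
    unfolding measurable_cong_sets[OF eq refl] case_prod_unfold mat_space_def
    by (intro measurable_restrict) (auto simp: mat_space_def[symmetric])
qed

lemma prob_space_GWig:
  assumes "prob_space (X n)" "sets (X n) = sets (vec_space n)"
  shows "prob_space (GWig n lam X)"
proof -
  interpret X: prob_space "X n" by fact
  interpret G: prob_space "GOE n" by (rule prob_space_GOE)
  interpret pair_prob_space "X n" "GOE n" ..
  show ?thesis
    unfolding GWig_def by (intro prob_space_distr measurable_GWig assms)
qed

lemma GWig_zero:
  assumes "prob_space (X n)" "sets (X n) = sets (vec_space n)"
  shows "GWig n 0 X = distr (GOE n) (mat_space n)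
    (\<lambda>W. \<lambda>ij\<in>{..<n} \<times> {..<n}. 1 / sqrt (real n) * W ij)"
proof -
  interpret X: prob_space "X n" by fact
  interpret G: prob_space "GOE n" by (rule prob_space_GOE)
  let ?f = "\<lambda>W. \<lambda>ij\<in>{..<n} \<times> {..<n}. 1 / sqrt (real n) * W ij"
  have f: "?f \<in> GOE n \<rightarrow>\<^sub>M mat_space n"
    unfolding measurable_cong_sets[OF sets_GOE refl] unfolding mat_space_def
    by (intro measurable_restrict borel_measurable_times measurable_component_singleton) auto
  have "GWig n 0 X = distr (X n \<Otimes>\<^sub>M GOE n) (mat_space n) (?f \<circ> snd)"
    unfolding GWig_def by (intro distr_cong refl) (auto simp: fun_eq_iff restrict_def)
  also have "\<dots> = distr (distr (X n \<Otimes>\<^sub>M GOE n) (GOE n) snd) (mat_space n) ?f"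
    by (intro distr_distr[symmetric] f measurable_snd)
  also have "distr (X n \<Otimes>\<^sub>M GOE n) (GOE n) snd = GOE n"
  proof (rule measure_eqI)
    fix A assume "A \<in> sets (distr (X n \<Otimes>\<^sub>M GOE n) (GOE n) snd)"
    then have A: "A \<in> sets (GOE n)" by simp
    have "emeasure (distr (X n \<Otimes>\<^sub>M GOE n) (GOE n) snd) A = emeasure (X n \<Otimes>\<^sub>M GOE n) (space (X n) \<times> A)"
      using A sets.sets_into_space[OF A]
      by (auto simp: emeasure_distr space_pair_measure intro!: arg_cong2[where f=emeasure])
    also have "\<dots> = emeasure (GOE n) A"
      using A by (simp add: G.emeasure_pair_measure_Times X.emeasure_space_1)
    finally show "emeasure (distr (X n \<Otimes>\<^sub>M GOE n) (GOE n) snd) A = emeasure (GOE n) A" .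
  qed simp
  finally show ?thesis .
qed

end

(* Second moment method. Let L be the likelihood ratio of the spiked law P to the null law Q, an
   average over x of Gaussian likelihood ratios. By Cauchy-Schwarz P(A)^2 <= E_Q[L^2] Q(A), so it
   suffices to bound E_Q[L^2] uniformly in n. Integrating out the noise for two independent replicas
   x, y gives E_Q[L^2] = E exp(n lam^2 <x,y>^2 / 2). Writing this exponential of a square as a Gaussian
   average of E exp(sqrt n lam t <x,y>) and using cosh u <= exp(u^2/2) coordinatewise bounds it by
   E exp(lam^2 t^2 / 2) = (1 - lam^2)^(-1/2), with t standard normal. *)

theory Submission
  imports Defs
begin

section \<open>Scalar exponential bounds and Gaussian integrals\<close>

text \<open>This is the sub-Gaussian bound for a random sign: the left side is cosh u, the moment
  generating function of a uniform sign.\<close>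

lemma exp_symmetric_average_le: "(exp u + exp (- u)) / 2 \<le> exp (u\<^sup>2 / 2)" for u :: real
proof -
  have pos: "1 + (1 / 2) * (exp (2 * \<bar>u\<bar>) - 1) > (0::real)"
    by (rule add_pos_nonneg) simp_all
  \<comment> \<open>The average is brought to the form of Hoeffding's auxiliary inequality with
    success probability 1/2 and range 2|u|; the absolute value is there because that inequality asks
    for a nonnegative range.\<close>
  have "(exp u + exp (- u)) / 2 = exp (- \<bar>u\<bar>) * (1 + (1 / 2) * (exp (2 * \<bar>u\<bar>) - 1))"
    by (cases "u \<ge> 0") (simp_all add: field_simps flip: exp_add)
  also have "\<dots> = exp (- (2 * \<bar>u\<bar>) * (1 / 2) + ln (1 + (1 / 2) * (exp (2 * \<bar>u\<bar>) - 1)))"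
    unfolding exp_add exp_ln[OF pos] by simp
  also have "\<dots> \<le> exp ((2 * \<bar>u\<bar>)\<^sup>2 / 8)"
    unfolding exp_le_cancel_iff by (rule Hoeffdings_lemma_aux) simp_all
  finally show ?thesis
    by (simp add: power_mult_distrib)
qed

text \<open>Completing the square: an exponential tilt moves the mean and costs a constant factor.
  Both the moment generating function and the likelihood ratio of a shifted normal come from
  this.\<close>

lemma normal_density_mult_exp:
  assumes "\<sigma> > 0"
  shows "normal_density \<mu> \<sigma> x * exp (a * (x - \<mu>) / \<sigma>\<^sup>2)
    = exp (a\<^sup>2 / (2 * \<sigma>\<^sup>2)) * normal_density (\<mu> + a) \<sigma> x"
proof -
  have "- (x - \<mu>)\<^sup>2 / (2 * \<sigma>\<^sup>2) + a * (x - \<mu>) / \<sigma>\<^sup>2 = a\<^sup>2 / (2 * \<sigma>\<^sup>2) + - (x - (\<mu> + a))\<^sup>2 / (2 * \<sigma>\<^sup>2)"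
    using assms by (simp add: field_simps power2_eq_square)
  then show ?thesis
    unfolding normal_density_def by (simp add: mult.assoc mult.left_commute flip: exp_add)
qed

lemma nn_integral_normal_density:
  assumes "\<sigma> > 0"
  shows "(\<integral>\<^sup>+ x. ennreal (normal_density \<mu> \<sigma> x) \<partial>lborel) = 1"
  using assms by (simp add: nn_integral_eq_integral)

lemma nn_integral_normal_exp:
  assumes "\<sigma> > 0"
  shows "(\<integral>\<^sup>+ x. ennreal (exp (a * x / \<sigma>\<^sup>2)) \<partial>density lborel (normal_density 0 \<sigma>))
    = ennreal (exp (a\<^sup>2 / (2 * \<sigma>\<^sup>2)))"
proof -
  have "(\<integral>\<^sup>+ x. ennreal (exp (a * x / \<sigma>\<^sup>2)) \<partial>density lborel (normal_density 0 \<sigma>))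
    = (\<integral>\<^sup>+ x. ennreal (exp (a\<^sup>2 / (2 * \<sigma>\<^sup>2))) * ennreal (normal_density a \<sigma> x) \<partial>lborel)"
    using normal_density_mult_exp[OF assms, of 0 _ a]
    by (simp add: nn_integral_density flip: ennreal_mult)
  then show ?thesis
    by (simp add: nn_integral_cmult nn_integral_normal_density assms)
qed

text \<open>A quadratic tilt keeps the density Gaussian but changes its variance to 1 / (1 - c),
  which is why c must stay below 1. The value is the ratio of the normalising constants.\<close>

lemma nn_integral_std_normal_exp_square:
  assumes "c < 1"
  shows "(\<integral>\<^sup>+ x. ennreal (exp (c * x\<^sup>2 / 2)) \<partial>density lborel (normal_density 0 1))
    = ennreal (1 / sqrt (1 - c))"
proof -
  \<comment> \<open>\<open>s\<close> is the standard deviation after the tilt.\<close>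
  define s where "s = 1 / sqrt (1 - c)"
  have s: "s > 0" "s\<^sup>2 = 1 / (1 - c)"
    using assms by (simp_all add: s_def power_divide)
  have "normal_density 0 1 x * exp (c * x\<^sup>2 / 2) = s * normal_density 0 s x" for x
  proof -
    have "- x\<^sup>2 / 2 + c * x\<^sup>2 / 2 = - x\<^sup>2 / (2 * s\<^sup>2)"
      using assms by (simp add: s(2) field_simps)
    moreover have "1 / sqrt (2 * pi) = s * (1 / sqrt (2 * pi * s\<^sup>2))"
      using s(1) by (simp add: real_sqrt_mult)
    ultimately show ?thesis
      unfolding normal_density_def by (simp only: mult.assoc diff_zero one_power2 mult_1_right flip: exp_add)
  qed
  then have "(\<integral>\<^sup>+ x. ennreal (exp (c * x\<^sup>2 / 2)) \<partial>density lborel (normal_density 0 1))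
    = (\<integral>\<^sup>+ x. ennreal s * ennreal (normal_density 0 s x) \<partial>lborel)"
    using s(1) by (simp add: nn_integral_density flip: ennreal_mult)
  then show ?thesis
    using s(1) by (simp add: nn_integral_cmult nn_integral_normal_density s_def)
qed

lemma distr_normal_shift:
  assumes "\<sigma> > 0"
  shows "distr (density lborel (normal_density 0 \<sigma>)) borel (\<lambda>x. m + x)
    = density lborel (normal_density m \<sigma>)"
proof -
  interpret prob_space "density lborel (normal_density 0 \<sigma>)"
    by (rule prob_space_normal_density[OF assms])
  \<comment> \<open>The identity is a normal variable under its own law, so the rule for affine
    images applies with slope 1.\<close>
  have "distributed (density lborel (normal_density 0 \<sigma>)) lborel (\<lambda>x. x) (normal_density 0 \<sigma>)"
    by (auto simp: distributed_def distr_id2)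
  then have "distributed (density lborel (normal_density 0 \<sigma>)) lborel (\<lambda>x. m + x) (normal_density m \<sigma>)"
    using normal_density_affine[of "\<lambda>x. x" 0 \<sigma> 1 m] assms by simp
  then have "distr (density lborel (normal_density 0 \<sigma>)) lborel (\<lambda>x. m + x) = density lborel (normal_density m \<sigma>)"
    by (rule distributed_distr_eq_density)
  then show ?thesis
    by (simp cong: distr_cong)
qed

section \<open>Product Gaussian measures and their likelihood ratios\<close>

text \<open>Both measures give a box the product of the masses of the coordinate preimages, and
  boxes determine a finite product measure.\<close>

lemma distr_PiM_componentwise:
  assumes fin: "finite I"
    and M: "\<And>i. i \<in> I \<Longrightarrow> prob_space (M i)"
    and f [measurable]: "\<And>i. i \<in> I \<Longrightarrow> f i \<in> M i \<rightarrow>\<^sub>M M' i"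
  shows "distr (Pi\<^sub>M I M) (Pi\<^sub>M I M') (\<lambda>x. \<lambda>i\<in>I. f i (x i)) = (\<Pi>\<^sub>M i\<in>I. distr (M i) (M' i) (f i))"
proof -
  \<comment> \<open>The product locales quantify over every index of the type, so both families are
    padded outside \<open>I\<close> with a point mass.\<close>
  define N where "N i = (if i \<in> I then M i else return (count_space UNIV) undefined)" for i
  define D where "D i = (if i \<in> I then distr (M i) (M' i) (f i) else return (count_space UNIV) undefined)" for i
  have N: "prob_space (N i)" and D: "prob_space (D i)" for i
    by (auto simp: N_def D_def M intro!: prob_space.prob_space_distr prob_space_return)
  interpret N: product_prob_space N
    by (simp add: product_prob_space_def product_sigma_finite_def product_prob_space_axioms_def N prob_space_imp_sigma_finite)
  interpret D: product_prob_space D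
    by (simp add: product_prob_space_def product_sigma_finite_def product_prob_space_axioms_def D prob_space_imp_sigma_finite)
  have f' [measurable]: "f i \<in> N i \<rightarrow>\<^sub>M M' i" if "i \<in> I" for i
    using that f by (simp add: N_def)
  have shift: "(\<lambda>x. \<lambda>i\<in>I. f i (x i)) \<in> Pi\<^sub>M I N \<rightarrow>\<^sub>M Pi\<^sub>M I M'"
    by measurable
  have "distr (Pi\<^sub>M I N) (Pi\<^sub>M I M') (\<lambda>x. \<lambda>i\<in>I. f i (x i)) = Pi\<^sub>M I D"
  proof (rule D.PiM_eqI)
    fix A assume A: "\<And>i. i \<in> I \<Longrightarrow> A i \<in> sets (D i)"
    then have A': "A i \<in> sets (M' i)" if "i \<in> I" for i
      using that by (force simp: D_def)
    have "(\<lambda>x. \<lambda>i\<in>I. f i (x i)) -` Pi\<^sub>E I A \<inter> space (Pi\<^sub>M I N) = Pi\<^sub>E I (\<lambda>i. f i -` A i \<inter> space (N i))"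
      by (auto simp: space_PiM PiE_iff)
    then have "emeasure (distr (Pi\<^sub>M I N) (Pi\<^sub>M I M') (\<lambda>x. \<lambda>i\<in>I. f i (x i))) (Pi\<^sub>E I A)
      = emeasure (Pi\<^sub>M I N) (Pi\<^sub>E I (\<lambda>i. f i -` A i \<inter> space (N i)))"
      using A' fin by (subst emeasure_distr[OF shift]) (auto intro: sets_PiM_I_finite)
    also have "\<dots> = (\<Prod>i\<in>I. emeasure (N i) (f i -` A i \<inter> space (N i)))"
      using fin measurable_sets[OF f' A'] by (intro N.emeasure_PiM) auto
    also have "\<dots> = (\<Prod>i\<in>I. emeasure (D i) (A i))"
      using f A' by (intro prod.cong refl) (simp add: N_def D_def emeasure_distr)
    finally show "emeasure (distr (Pi\<^sub>M I N) (Pi\<^sub>M I M') (\<lambda>x. \<lambda>i\<in>I. f i (x i))) (Pi\<^sub>E I A)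
      = (\<Prod>i\<in>I. emeasure (D i) (A i))" .
  qed (use fin in \<open>auto simp: D_def intro!: sets_PiM_cong\<close>)
  moreover have "Pi\<^sub>M I N = Pi\<^sub>M I M" "Pi\<^sub>M I D = (\<Pi>\<^sub>M i\<in>I. distr (M i) (M' i) (f i))"
    by (intro PiM_cong; simp add: N_def D_def)+
  ultimately show ?thesis
    by simp
qed

text \<open>
  The likelihood ratio of independent normals with means \<open>m i\<close> to centred ones, with common
  standard deviations \<open>\<sigma> i\<close>.
\<close>

definition gauss_lr :: "'i set \<Rightarrow> ('i \<Rightarrow> real) \<Rightarrow> ('i \<Rightarrow> real) \<Rightarrow> ('i \<Rightarrow> real) \<Rightarrow> real" where
  "gauss_lr I \<sigma> m g = (\<Prod>i\<in>I. exp ((m i * g i - (m i)\<^sup>2 / 2) / (\<sigma> i)\<^sup>2))"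

context
  fixes I :: "'i set" and \<sigma> :: "'i \<Rightarrow> real"
  assumes fin: "finite I" and \<sigma>_pos: "\<And>i. \<sigma> i > 0"
begin

lemma nn_integral_PiM_normal_prod:
  assumes "\<And>i. i \<in> I \<Longrightarrow> f i \<in> borel_measurable borel"
  shows "(\<integral>\<^sup>+ g. (\<Prod>i\<in>I. f i (g i)) \<partial>(\<Pi>\<^sub>M i\<in>I. density lborel (normal_density 0 (\<sigma> i))))
    = (\<Prod>i\<in>I. \<integral>\<^sup>+ x. f i x \<partial>density lborel (normal_density 0 (\<sigma> i)))"
proof -
  interpret prob_space "density lborel (normal_density 0 (\<sigma> i))" for i
    by (rule prob_space_normal_density[OF \<sigma>_pos])
  interpret product_sigma_finite "\<lambda>i. density lborel (normal_density 0 (\<sigma> i))" ..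
  show ?thesis
    using fin assms by (intro product_nn_integral_prod) simp_all
qed

text \<open>In each coordinate the two ratios multiply to one tilt in direction
  \<open>m i + m' i\<close>. Its Gaussian integral contributes (m + m')^2, the normalisations
  subtract m^2 + m'^2, and only the cross term survives.\<close>

lemma nn_integral_gauss_lr_mult:
  "(\<integral>\<^sup>+ g. ennreal (gauss_lr I \<sigma> m g) * ennreal (gauss_lr I \<sigma> m' g)
      \<partial>(\<Pi>\<^sub>M i\<in>I. density lborel (normal_density 0 (\<sigma> i))))
    = ennreal (exp (\<Sum>i\<in>I. m i * m' i / (\<sigma> i)\<^sup>2))"
proof -
  \<comment> \<open>\<open>c i\<close> collects the factors that do not depend on
    \<open>g\<close>.\<close>
  define c where "c i = exp (- ((m i)\<^sup>2 + (m' i)\<^sup>2) / (2 * (\<sigma> i)\<^sup>2))" for i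
  have c_nonneg: "c i \<ge> 0" for i
    by (simp add: c_def)
  have eq: "ennreal (gauss_lr I \<sigma> m g) * ennreal (gauss_lr I \<sigma> m' g)
    = (\<Prod>i\<in>I. ennreal (c i) * ennreal (exp ((m i + m' i) * g i / (\<sigma> i)\<^sup>2)))" for g
    unfolding gauss_lr_def c_def
    by (simp add: prod_ennreal prod_nonneg flip: ennreal_mult prod.distrib exp_add)
       (simp add: add_divide_distrib diff_divide_distrib algebra_simps)
  have c: "c i * exp ((m i + m' i)\<^sup>2 / (2 * (\<sigma> i)\<^sup>2)) = exp (m i * m' i / (\<sigma> i)\<^sup>2)" for i
  proof -
    have "- ((m i)\<^sup>2 + (m' i)\<^sup>2) / (2 * (\<sigma> i)\<^sup>2) + (m i + m' i)\<^sup>2 / (2 * (\<sigma> i)\<^sup>2) = m i * m' i / (\<sigma> i)\<^sup>2"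
      using \<sigma>_pos[of i] by (simp add: field_simps power2_eq_square)
    then show ?thesis
      unfolding c_def by (simp only: flip: exp_add)
  qed
  have one: "(\<integral>\<^sup>+ x. ennreal (c i) * ennreal (exp ((m i + m' i) * x / (\<sigma> i)\<^sup>2))
      \<partial>density lborel (normal_density 0 (\<sigma> i))) = ennreal (exp (m i * m' i / (\<sigma> i)\<^sup>2))" for i
    by (simp add: nn_integral_cmult nn_integral_normal_exp \<sigma>_pos)
       (simp add: c c_nonneg flip: ennreal_mult)
  show ?thesis
    unfolding eq
    by (subst nn_integral_PiM_normal_prod) (simp_all add: one prod_ennreal exp_sum fin)
qed

lemma borel_measurable_gauss_lr:
  "gauss_lr I \<sigma> m \<in> borel_measurable (\<Pi>\<^sub>M i\<in>I. borel)"
  unfolding gauss_lr_def by measurable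

text \<open>The finite-dimensional Cameron-Martin formula. The shifted product is the product of
  shifted normals, and it agrees with the density on boxes because the ratio factorises over
  coordinates.\<close>

lemma distr_PiM_normal_shift:
  "distr (\<Pi>\<^sub>M i\<in>I. density lborel (normal_density 0 (\<sigma> i))) (\<Pi>\<^sub>M i\<in>I. borel) (\<lambda>g. \<lambda>i\<in>I. m i + g i)
    = density (\<Pi>\<^sub>M i\<in>I. density lborel (normal_density 0 (\<sigma> i))) (gauss_lr I \<sigma> m)"
proof -
  let ?N = "\<lambda>\<mu> i. density lborel (normal_density (\<mu> i) (\<sigma> i))"
  have sets_N: "sets (Pi\<^sub>M I (?N \<mu>)) = sets (\<Pi>\<^sub>M i\<in>I. borel)" for \<mu>
    by (intro sets_PiM_cong) simp_all
  have ps: "prob_space (?N \<mu> i)" for \<mu> i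
    by (rule prob_space_normal_density[OF \<sigma>_pos])
  interpret prob_space "?N m i" for i by (rule ps)
  interpret product_sigma_finite "?N m" ..
  have "distr (Pi\<^sub>M I (?N (\<lambda>_. 0))) (\<Pi>\<^sub>M i\<in>I. borel) (\<lambda>g. \<lambda>i\<in>I. m i + g i)
      = Pi\<^sub>M I (\<lambda>i. distr (?N (\<lambda>_. 0) i) borel (\<lambda>x. m i + x))"
    by (rule distr_PiM_componentwise) (simp_all add: fin ps[of "\<lambda>_. 0", simplified])
  also have "\<dots> = Pi\<^sub>M I (?N m)"
    by (simp add: distr_normal_shift \<sigma>_pos)
  also have "\<dots> = density (Pi\<^sub>M I (?N (\<lambda>_. 0))) (gauss_lr I \<sigma> m)"
  proof (rule PiM_eqI[symmetric])
    fix A assume A: "\<And>i. i \<in> I \<Longrightarrow> A i \<in> sets (?N m i)"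
    have B: "Pi\<^sub>E I A \<in> sets (Pi\<^sub>M I (?N (\<lambda>_. 0)))"
      using A fin by (intro sets_PiM_I_finite) auto
    have M: "gauss_lr I \<sigma> m \<in> borel_measurable (Pi\<^sub>M I (?N (\<lambda>_. 0)))"
      using borel_measurable_gauss_lr unfolding measurable_cong_sets[OF sets_N refl] .
    \<comment> \<open>One coordinate of the density, restricted to its side of the box, so that the
      integral over the box splits into one-dimensional ones.\<close>
    define f where "f i x = ennreal (exp ((m i * x - (m i)\<^sup>2 / 2) / (\<sigma> i)\<^sup>2)) * indicator (A i) x" for i x
    have "emeasure (density (Pi\<^sub>M I (?N (\<lambda>_. 0))) (gauss_lr I \<sigma> m)) (Pi\<^sub>E I A)
      = (\<integral>\<^sup>+ g. (\<Prod>i\<in>I. f i (g i)) \<partial>Pi\<^sub>M I (?N (\<lambda>_. 0)))"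
    proof (subst emeasure_density[OF measurable_compose[OF M measurable_ennreal] B], rule nn_integral_cong)
      fix g assume "g \<in> space (Pi\<^sub>M I (?N (\<lambda>_. 0)))"
      \<comment> \<open>Membership of \<open>g\<close> in the space supplies extensionality, hence
        lying in the box reduces to coordinatewise conditions.\<close>
      then have "indicator (Pi\<^sub>E I A) g = (\<Prod>i\<in>I. indicator (A i) (g i) :: ennreal)"
        using fin by (auto simp: space_PiM PiE_iff indicator_def)
      then show "ennreal (gauss_lr I \<sigma> m g) * indicator (Pi\<^sub>E I A) g = (\<Prod>i\<in>I. f i (g i))"
        by (simp add: f_def gauss_lr_def prod.distrib prod_ennreal)
    qed
    also have "\<dots> = (\<Prod>i\<in>I. \<integral>\<^sup>+ x. f i x \<partial>?N (\<lambda>_. 0) i)"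
      by (rule nn_integral_PiM_normal_prod) (use A in \<open>auto simp: f_def\<close>)
    also have "\<dots> = (\<Prod>i\<in>I. emeasure (?N m i) (A i))"
    proof (rule prod.cong)
      fix i assume i: "i \<in> I"
      have "normal_density 0 (\<sigma> i) x * exp ((m i * x - (m i)\<^sup>2 / 2) / (\<sigma> i)\<^sup>2) = normal_density (m i) (\<sigma> i) x" for x
      proof -
        have "(m i * x - (m i)\<^sup>2 / 2) / (\<sigma> i)\<^sup>2 = m i * (x - 0) / (\<sigma> i)\<^sup>2 - (m i)\<^sup>2 / (2 * (\<sigma> i)\<^sup>2)"
          by (simp add: diff_divide_distrib)
        then show ?thesis
          using normal_density_mult_exp[OF \<sigma>_pos, of 0 i x "m i"] by (simp add: exp_diff)
      qed
      then have "ennreal (normal_density 0 (\<sigma> i) x) * f i x = ennreal (normal_density (m i) (\<sigma> i) x) * indicator (A i) x" for x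
        unfolding f_def by (metis ennreal_mult exp_ge_zero mult.assoc normal_density_nonneg)
      moreover have "f i \<in> borel_measurable lborel"
        unfolding f_def[abs_def] using A[OF i] by simp
      ultimately show "(\<integral>\<^sup>+ x. f i x \<partial>?N (\<lambda>_. 0) i) = emeasure (?N m i) (A i)"
        using A[OF i] by (simp add: nn_integral_density emeasure_density)
    qed simp
    finally show "emeasure (density (Pi\<^sub>M I (?N (\<lambda>_. 0))) (gauss_lr I \<sigma> m)) (Pi\<^sub>E I A)
      = (\<Prod>i\<in>I. emeasure (?N m i) (A i))" .
  qed (simp_all add: fin sets_N)
  finally show ?thesis .
qed

end


section \<open>The upper-triangular coordinates of the spiked matrix\<close>

definition upper :: "nat \<Rightarrow> (nat \<times> nat) set" where
  "upper n = {(i, j). i \<le> j \<and> j < n}"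

definition goe_sd :: "nat \<times> nat \<Rightarrow> real" where
  "goe_sd ij = (if fst ij = snd ij then sqrt 2 else 1)"

text \<open>
  The matrix is rescaled by \<open>sqrt n\<close>: on the upper triangle, \<open>sqrt n * Y\<close> is the GOE noise shifted by
  \<open>spike n lam x\<close>, and \<open>symmetrize\<close> recovers \<open>Y\<close>.
\<close>

definition spike :: "nat \<Rightarrow> real \<Rightarrow> (nat \<Rightarrow> real) \<Rightarrow> nat \<times> nat \<Rightarrow> real" where
  "spike n lam x ij = sqrt (real n) * lam * (x (fst ij) * x (snd ij))"

definition symmetrize :: "nat \<Rightarrow> (nat \<times> nat \<Rightarrow> real) \<Rightarrow> nat \<times> nat \<Rightarrow> real" where
  "symmetrize n g = (\<lambda>(i, j)\<in>{..<n} \<times> {..<n}. 1 / sqrt (real n) * g (min i j, max i j))"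

lemma goe_sd_pos: "goe_sd ij > 0"
  by (simp add: goe_sd_def)

lemma finite_upper: "finite (upper n)"
  by (rule finite_subset[of _ "{..<n} \<times> {..<n}"]) (auto simp: upper_def)

lemma goe_upper_eq: "goe_upper n = (\<Pi>\<^sub>M ij\<in>upper n. density lborel (normal_density 0 (goe_sd ij)))"
  unfolding goe_upper_def upper_def goe_sd_def ..

lemma sets_goe_upper [measurable_cong]: "sets (goe_upper n) = sets (\<Pi>\<^sub>M ij\<in>upper n. borel)"
  unfolding goe_upper_eq by (intro sets_PiM_cong) simp_all

lemma sets_iid_pm1_borel [measurable_cong]: "sets (iid_pm1 n) = sets (\<Pi>\<^sub>M i\<in>{..<n}. borel)"
  by (simp add: sets_iid_pm1 vec_space_def)

lemma measurable_symmetrize [measurable]: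
  "symmetrize n \<in> (\<Pi>\<^sub>M ij\<in>upper n. borel) \<rightarrow>\<^sub>M mat_space n"
proof -
  have "(\<lambda>g. 1 / sqrt (real n) * g (min i j, max i j)) \<in> borel_measurable (\<Pi>\<^sub>M ij\<in>upper n. borel)"
    if "i < n" "j < n" for i j
  proof -
    have "(min i j, max i j) \<in> upper n"
      using that by (simp add: upper_def)
    then show ?thesis
      by (intro borel_measurable_times borel_measurable_const measurable_component_singleton)
  qed
  then show ?thesis
    unfolding symmetrize_def[abs_def] mat_space_def
    by (intro measurable_restrict) (clarsimp simp only: mem_Sigma_iff lessThan_iff prod.case)
qed

text \<open>In the square of the sum each off-diagonal pair occurs twice and each diagonal term
  once. The weight 2 on the diagonal is the GOE variance there, so half of the square comes out
  exactly.\<close>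

lemma sum_upper_mult:
  fixes a :: "nat \<Rightarrow> real"
  shows "(\<Sum>(i, j)\<in>upper n. a i * a j / (if i = j then 2 else 1)) = (\<Sum>i<n. a i)\<^sup>2 / 2"
proof (induction n)
  case (Suc n)
  \<comment> \<open>Passing to the next dimension adds the last column, diagonal entry
    included.\<close>
  have eq: "upper (Suc n) = upper n \<union> (\<lambda>i. (i, n)) ` {..n}"
    by (auto simp: upper_def)
  have "(\<Sum>(i, j)\<in>upper (Suc n). a i * a j / (if i = j then 2 else 1))
    = (\<Sum>i<n. a i)\<^sup>2 / 2 + (\<Sum>i\<le>n. a i * a n / (if i = n then 2 else 1))"
  proof -
    have "upper n \<inter> (\<lambda>i. (i, n)) ` {..n} = {}"
      by (auto simp: upper_def)
    then show ?thesis
      unfolding eq Suc.IH[symmetric]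
      by (subst sum.union_disjoint) (simp_all add: finite_upper sum.reindex inj_on_def)
  qed
  also have "(\<Sum>i\<le>n. a i * a n / (if i = n then 2 else 1)) = (\<Sum>i<n. a i) * a n + (a n)\<^sup>2 / 2"
    by (simp add: sum_distrib_right power2_eq_square flip: lessThan_Suc_atMost)
  finally show ?case
    by (simp add: power2_eq_square field_simps)
qed (simp add: upper_def)

text \<open>Thus the exponent of the two-replica integral depends on \<open>x\<close> and
  \<open>y\<close> only through their overlap.\<close>

lemma sum_spike_mult:
  "(\<Sum>ij\<in>upper n. spike n lam x ij * spike n lam y ij / (goe_sd ij)\<^sup>2)
    = real n * lam\<^sup>2 * (\<Sum>i<n. x i * y i)\<^sup>2 / 2"
proof -
  have "(\<Sum>ij\<in>upper n. spike n lam x ij * spike n lam y ij / (goe_sd ij)\<^sup>2)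
    = (\<Sum>(i, j)\<in>upper n. real n * lam\<^sup>2 * ((x i * y i) * (x j * y j) / (if i = j then 2 else 1)))"
    by (intro sum.cong) (auto simp: spike_def goe_sd_def power2_eq_square mult_ac)
  also have "\<dots> = real n * lam\<^sup>2 * (\<Sum>(i, j)\<in>upper n. (x i * y i) * (x j * y j) / (if i = j then 2 else 1))"
    unfolding sum_distrib_left by (simp add: case_prod_unfold)
  finally show ?thesis
    by (simp add: sum_upper_mult)
qed

section \<open>The spiked law as a mixture of Gaussian shifts\<close>

text \<open>Valued in \<open>ennreal\<close>, so that Tonelli and Cauchy-Schwarz apply without
  integrability conditions.\<close>

definition spike_lr :: "nat \<Rightarrow> real \<Rightarrow> (nat \<Rightarrow> real) \<Rightarrow> (nat \<times> nat \<Rightarrow> real) \<Rightarrow> ennreal" where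
  "spike_lr n lam x g = ennreal (gauss_lr (upper n) goe_sd (spike n lam x) g)"

text \<open>Here the shift varies together with the noise. The composed form lets
  \<open>measurable\<close> prove joint measurability on the product spaces that arise when
  integrals are exchanged.\<close>

lemma measurable_spike_lr [measurable (raw)]:
  assumes [measurable]: "f \<in> M \<rightarrow>\<^sub>M (\<Pi>\<^sub>M i\<in>{..<n}. borel)" "h \<in> M \<rightarrow>\<^sub>M (\<Pi>\<^sub>M ij\<in>upper n. borel)"
  shows "(\<lambda>z. spike_lr n lam (f z) (h z)) \<in> borel_measurable M"
proof -
  have "(\<lambda>z. exp ((spike n lam (f z) ij * h z ij - (spike n lam (f z) ij)\<^sup>2 / 2) / (goe_sd ij)\<^sup>2)) \<in> borel_measurable M"
    if "ij \<in> upper n" for ij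
  proof -
    have [measurable]: "(\<lambda>z. f z (fst ij)) \<in> borel_measurable M" "(\<lambda>z. f z (snd ij)) \<in> borel_measurable M"
      "(\<lambda>z. h z ij) \<in> borel_measurable M"
      using that by (auto simp: upper_def intro!: measurable_compose[OF assms(1)] measurable_compose[OF assms(2)]
        measurable_component_singleton)
    show ?thesis
      unfolding spike_def by measurable
  qed
  then show ?thesis
    unfolding spike_lr_def gauss_lr_def by measurable
qed

lemma nn_integral_GOE:
  assumes "f \<in> borel_measurable (mat_space n)"
  shows "(\<integral>\<^sup>+ W. f W \<partial>GOE n)
    = (\<integral>\<^sup>+ g. f (\<lambda>(i, j)\<in>{..<n} \<times> {..<n}. g (min i j, max i j)) \<partial>goe_upper n)"
  unfolding GOE_def using assms by (intro nn_integral_distr measurable_goe_symmetrize) simp_all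

text \<open>The spike is symmetric in its two indices, so adding it commutes with symmetrising and
  can be done on the independent upper-triangular entries.\<close>

lemma emeasure_GWig:
  assumes A: "A \<in> sets (mat_space n)"
  shows "emeasure (GWig n lam iid_pm1) A
    = (\<integral>\<^sup>+ x. \<integral>\<^sup>+ g. indicator A (symmetrize n (\<lambda>ij\<in>upper n. spike n lam x ij + g ij)) \<partial>goe_upper n \<partial>iid_pm1 n)"
proof -
  interpret G: prob_space "GOE n" by (rule prob_space_GOE)
  let ?F = "\<lambda>(x, W). \<lambda>(i, j)\<in>{..<n} \<times> {..<n}. lam * (x i * x j) + 1 / sqrt (real n) * W (i, j)"
  have F: "?F \<in> iid_pm1 n \<Otimes>\<^sub>M GOE n \<rightarrow>\<^sub>M mat_space n"
    by (rule measurable_GWig[OF sets_iid_pm1])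
  have ind: "(\<lambda>p. indicator A (?F p) :: ennreal) \<in> borel_measurable (iid_pm1 n \<Otimes>\<^sub>M GOE n)"
    using measurable_compose[OF F borel_measurable_indicator[OF A]] .
  have "emeasure (GWig n lam iid_pm1) A = (\<integral>\<^sup>+ Y. indicator A Y \<partial>GWig n lam iid_pm1)"
    using A by (simp add: GWig_def)
  also have "\<dots> = (\<integral>\<^sup>+ p. indicator A (?F p) \<partial>(iid_pm1 n \<Otimes>\<^sub>M GOE n))"
    unfolding GWig_def using A by (intro nn_integral_distr F) simp
  also have "\<dots> = (\<integral>\<^sup>+ x. \<integral>\<^sup>+ W. indicator A (?F (x, W)) \<partial>GOE n \<partial>iid_pm1 n)"
    by (rule G.nn_integral_fst[symmetric]) (rule ind)
  also have "\<dots> = (\<integral>\<^sup>+ x. \<integral>\<^sup>+ g. indicator A (symmetrize n (\<lambda>ij\<in>upper n. spike n lam x ij + g ij)) \<partial>goe_upper n \<partial>iid_pm1 n)"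
  proof (rule nn_integral_cong)
    fix x assume x: "x \<in> space (iid_pm1 n)"
    have "(\<lambda>W. indicator A (?F (x, W)) :: ennreal) \<in> borel_measurable (mat_space n)"
      using measurable_compose[OF measurable_Pair1'[OF x] ind]
      unfolding measurable_cong_sets[OF sets_GOE refl] by simp
    moreover have "?F (x, \<lambda>(i, j)\<in>{..<n} \<times> {..<n}. g (min i j, max i j))
      = symmetrize n (\<lambda>ij\<in>upper n. spike n lam x ij + g ij)" for g
    proof
      fix p
      show "?F (x, \<lambda>(i, j)\<in>{..<n} \<times> {..<n}. g (min i j, max i j)) p
        = symmetrize n (\<lambda>ij\<in>upper n. spike n lam x ij + g ij) p"
        \<comment> \<open>For an entry inside the index square n is positive, so the factor
          \<open>sqrt n\<close> in \<open>spike\<close> cancels against the rescaling in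
          \<open>symmetrize\<close>.\<close>
        by (cases p) (auto simp: symmetrize_def upper_def spike_def restrict_def field_simps min_def max_def)
    qed
    ultimately show "(\<integral>\<^sup>+ W. indicator A (?F (x, W)) \<partial>GOE n)
      = (\<integral>\<^sup>+ g. indicator A (symmetrize n (\<lambda>ij\<in>upper n. spike n lam x ij + g ij)) \<partial>goe_upper n)"
      by (subst nn_integral_GOE) simp_all
  qed
  finally show ?thesis .
qed

text \<open>For fixed \<open>x\<close> the shifted noise has density
  \<open>spike_lr n lam x\<close>; Tonelli then moves the average over the prior inside, which
  yields the likelihood ratio of the mixture.\<close>

lemma emeasure_GWig_density:
  assumes A [measurable]: "A \<in> sets (mat_space n)"
  shows "emeasure (GWig n lam iid_pm1) A
    = (\<integral>\<^sup>+ g. (\<integral>\<^sup>+ x. spike_lr n lam x g \<partial>iid_pm1 n) * indicator A (symmetrize n g) \<partial>goe_upper n)"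
proof -
  interpret X: prob_space "iid_pm1 n" by (rule prob_space_iid_pm1)
  interpret G: prob_space "goe_upper n" by (rule prob_space_goe_upper)
  interpret pair_sigma_finite "iid_pm1 n" "goe_upper n" ..
  have "emeasure (GWig n lam iid_pm1) A
    = (\<integral>\<^sup>+ x. \<integral>\<^sup>+ g. spike_lr n lam x g * indicator A (symmetrize n g) \<partial>goe_upper n \<partial>iid_pm1 n)"
    unfolding emeasure_GWig[OF A]
  proof (rule nn_integral_cong)
    fix x
    let ?s = "\<lambda>g. \<lambda>ij\<in>upper n. spike n lam x ij + g ij"
    have s: "?s \<in> goe_upper n \<rightarrow>\<^sub>M (\<Pi>\<^sub>M ij\<in>upper n. borel)"
      by measurable
    have "(\<integral>\<^sup>+ g. indicator A (symmetrize n (?s g)) \<partial>goe_upper n)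
      = (\<integral>\<^sup>+ g. indicator A (symmetrize n g) \<partial>distr (goe_upper n) (\<Pi>\<^sub>M ij\<in>upper n. borel) ?s)"
      by (rule nn_integral_distr[symmetric, OF s]) measurable
    also have "\<dots> = (\<integral>\<^sup>+ g. spike_lr n lam x g * indicator A (symmetrize n g) \<partial>goe_upper n)"
      unfolding goe_upper_eq distr_PiM_normal_shift[OF finite_upper goe_sd_pos] spike_lr_def
      unfolding goe_upper_eq[symmetric]
      by (rule nn_integral_density)
         (use measurable_compose[OF borel_measurable_gauss_lr[OF finite_upper goe_sd_pos] measurable_ennreal] in measurable)
    finally show "(\<integral>\<^sup>+ g. indicator A (symmetrize n (?s g)) \<partial>goe_upper n)
      = (\<integral>\<^sup>+ g. spike_lr n lam x g * indicator A (symmetrize n g) \<partial>goe_upper n)" .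
  qed
  also have "\<dots> = (\<integral>\<^sup>+ g. \<integral>\<^sup>+ x. spike_lr n lam x g * indicator A (symmetrize n g) \<partial>iid_pm1 n \<partial>goe_upper n)"
    by (rule Fubini'[symmetric]) measurable
  also have "\<dots> = (\<integral>\<^sup>+ g. (\<integral>\<^sup>+ x. spike_lr n lam x g \<partial>iid_pm1 n) * indicator A (symmetrize n g) \<partial>goe_upper n)"
  proof (rule nn_integral_cong)
    fix g assume "g \<in> space (goe_upper n)"
    \<comment> \<open>The measurability rule for \<open>spike_lr\<close> expects maps as arguments,
      so the fixed \<open>g\<close> enters as a constant map.\<close>
    then have [measurable]: "(\<lambda>_. g) \<in> iid_pm1 n \<rightarrow>\<^sub>M (\<Pi>\<^sub>M ij\<in>upper n. borel)"
      by (simp add: sets_eq_imp_space_eq[OF sets_goe_upper])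
    show "(\<integral>\<^sup>+ x. spike_lr n lam x g * indicator A (symmetrize n g) \<partial>iid_pm1 n)
      = (\<integral>\<^sup>+ x. spike_lr n lam x g \<partial>iid_pm1 n) * indicator A (symmetrize n g)"
      by (rule nn_integral_multc) measurable
  qed
  finally show ?thesis .
qed

lemma emeasure_GWig_null:
  assumes A [measurable]: "A \<in> sets (mat_space n)"
  shows "emeasure (GWig_null n) A = (\<integral>\<^sup>+ g. indicator A (symmetrize n g) \<partial>goe_upper n)"
proof -
  interpret X: prob_space "iid_pm1 n" by (rule prob_space_iid_pm1)
  have "spike_lr n 0 x g = 1" for x g
    by (simp add: spike_lr_def gauss_lr_def spike_def)
  then show ?thesis
    unfolding GWig_null_def emeasure_GWig_density[OF A] by (simp add: X.emeasure_space_1)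
qed

section \<open>The second moment of the likelihood ratio\<close>

lemma nn_integral_iid_pm1_prod:
  assumes "\<And>i. i < n \<Longrightarrow> f i \<in> borel_measurable borel"
  shows "(\<integral>\<^sup>+ x. (\<Prod>i<n. f i (x i)) \<partial>iid_pm1 n)
    = (\<Prod>i<n. (f i (1 / sqrt (real n)) + f i (- 1 / sqrt (real n))) / 2)"
proof -
  let ?S = "{1 / sqrt (real n), - 1 / sqrt (real n)}"
  let ?R = "distr (measure_pmf (pmf_of_set ?S)) borel (\<lambda>t. t)"
  interpret prob_space ?R
    by (intro prob_space.prob_space_distr measure_pmf.prob_space_axioms) simp
  interpret product_sigma_finite "\<lambda>_. ?R" ..
  have "(\<integral>\<^sup>+ x. (\<Prod>i<n. f i (x i)) \<partial>iid_pm1 n) = (\<Prod>i<n. \<integral>\<^sup>+ t. f i t \<partial>?R)"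
    unfolding iid_pm1_def using assms by (intro product_nn_integral_prod) simp_all
  also have "\<dots> = (\<Prod>i<n. (f i (1 / sqrt (real n)) + f i (- 1 / sqrt (real n))) / 2)"
  proof (rule prod.cong)
    fix i assume i: "i \<in> {..<n}"
    \<comment> \<open>An index below n forces n > 0, so the two atoms differ and each has mass 1/2.
      In dimension 0 they coincide, but then the product is empty.\<close>
    then have "1 / sqrt (real n) \<noteq> - 1 / sqrt (real n)"
      by auto
    then show "(\<integral>\<^sup>+ t. f i t \<partial>?R) = (f i (1 / sqrt (real n)) + f i (- 1 / sqrt (real n))) / 2"
      using i assms by (simp add: nn_integral_distr nn_integral_pmf_of_set)
  qed simp
  finally show ?thesis .
qed

text \<open>By independence the integral is a product of hyperbolic cosines at
  \<open>a i / sqrt n\<close>, each bounded by the sub-Gaussian estimate.\<close>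

lemma nn_integral_iid_pm1_exp_le:
  "(\<integral>\<^sup>+ y. ennreal (exp (\<Sum>i<n. a i * y i)) \<partial>iid_pm1 n) \<le> ennreal (exp ((\<Sum>i<n. (a i)\<^sup>2) / (2 * real n)))"
proof -
  have "(\<integral>\<^sup>+ y. ennreal (exp (\<Sum>i<n. a i * y i)) \<partial>iid_pm1 n)
    = (\<integral>\<^sup>+ y. (\<Prod>i<n. ennreal (exp (a i * y i))) \<partial>iid_pm1 n)"
    by (simp add: exp_sum prod_ennreal)
  also have "\<dots> = (\<Prod>i<n. (ennreal (exp (a i * (1 / sqrt (real n)))) + ennreal (exp (a i * (- 1 / sqrt (real n))))) / 2)"
    by (rule nn_integral_iid_pm1_prod) measurable
  also have "\<dots> \<le> (\<Prod>i<n. ennreal (exp ((a i)\<^sup>2 / (2 * real n))))"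
  proof (intro prod_mono_ennreal)
    fix i
    have "(ennreal (exp (a i * (1 / sqrt (real n)))) + ennreal (exp (a i * (- 1 / sqrt (real n))))) / 2
      = ennreal ((exp (a i / sqrt (real n)) + exp (- (a i / sqrt (real n)))) / 2)"
      by (simp flip: ennreal_plus ennreal_numeral add: divide_ennreal)
    also have "\<dots> \<le> ennreal (exp ((a i / sqrt (real n))\<^sup>2 / 2))"
      by (intro ennreal_leI exp_symmetric_average_le)
    finally show "(ennreal (exp (a i * (1 / sqrt (real n)))) + ennreal (exp (a i * (- 1 / sqrt (real n))))) / 2
      \<le> ennreal (exp ((a i)\<^sup>2 / (2 * real n)))"
      by (simp add: power_divide mult.commute)
  qed
  also have "\<dots> = ennreal (exp ((\<Sum>i<n. (a i)\<^sup>2) / (2 * real n)))"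
    by (simp add: prod_ennreal exp_sum sum_divide_distrib)
  finally show ?thesis .
qed

text \<open>The square of an average is an average over two independent replicas; Tonelli makes the
  noise integral innermost, where it has a closed form.\<close>

lemma nn_integral_spike_lr_square:
  "(\<integral>\<^sup>+ g. (\<integral>\<^sup>+ x. spike_lr n lam x g \<partial>iid_pm1 n)\<^sup>2 \<partial>goe_upper n)
    = (\<integral>\<^sup>+ x. \<integral>\<^sup>+ y. ennreal (exp (real n * lam\<^sup>2 * (\<Sum>i<n. x i * y i)\<^sup>2 / 2)) \<partial>iid_pm1 n \<partial>iid_pm1 n)"
proof -
  interpret X: prob_space "iid_pm1 n" by (rule prob_space_iid_pm1)
  interpret G: prob_space "goe_upper n" by (rule prob_space_goe_upper)
  interpret pair_sigma_finite "iid_pm1 n" "goe_upper n" ..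
  have "(\<integral>\<^sup>+ g. (\<integral>\<^sup>+ x. spike_lr n lam x g \<partial>iid_pm1 n)\<^sup>2 \<partial>goe_upper n)
    = (\<integral>\<^sup>+ g. \<integral>\<^sup>+ x. \<integral>\<^sup>+ y. spike_lr n lam x g * spike_lr n lam y g \<partial>iid_pm1 n \<partial>iid_pm1 n \<partial>goe_upper n)"
    unfolding power2_eq_square
  proof (rule nn_integral_cong)
    fix g assume "g \<in> space (goe_upper n)"
    then have [measurable]: "(\<lambda>_. g) \<in> iid_pm1 n \<rightarrow>\<^sub>M (\<Pi>\<^sub>M ij\<in>upper n. borel)"
      by (simp add: sets_eq_imp_space_eq[OF sets_goe_upper])
    have [measurable]: "(\<lambda>x. spike_lr n lam x g) \<in> borel_measurable (iid_pm1 n)"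
      by measurable
    show "(\<integral>\<^sup>+ x. spike_lr n lam x g \<partial>iid_pm1 n) * (\<integral>\<^sup>+ x. spike_lr n lam x g \<partial>iid_pm1 n)
      = (\<integral>\<^sup>+ x. \<integral>\<^sup>+ y. spike_lr n lam x g * spike_lr n lam y g \<partial>iid_pm1 n \<partial>iid_pm1 n)"
      by (simp add: nn_integral_cmult nn_integral_multc)
  qed
  also have "\<dots> = (\<integral>\<^sup>+ x. \<integral>\<^sup>+ g. \<integral>\<^sup>+ y. spike_lr n lam x g * spike_lr n lam y g \<partial>iid_pm1 n \<partial>goe_upper n \<partial>iid_pm1 n)"
    by (rule Fubini') measurable
  also have "\<dots> = (\<integral>\<^sup>+ x. \<integral>\<^sup>+ y. \<integral>\<^sup>+ g. spike_lr n lam x g * spike_lr n lam y g \<partial>goe_upper n \<partial>iid_pm1 n \<partial>iid_pm1 n)"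
  proof (rule nn_integral_cong)
    fix x assume "x \<in> space (iid_pm1 n)"
    then have [measurable]: "(\<lambda>_. x) \<in> iid_pm1 n \<Otimes>\<^sub>M goe_upper n \<rightarrow>\<^sub>M (\<Pi>\<^sub>M i\<in>{..<n}. borel)"
      by (simp add: sets_eq_imp_space_eq[OF sets_iid_pm1_borel])
    show "(\<integral>\<^sup>+ g. \<integral>\<^sup>+ y. spike_lr n lam x g * spike_lr n lam y g \<partial>iid_pm1 n \<partial>goe_upper n)
      = (\<integral>\<^sup>+ y. \<integral>\<^sup>+ g. spike_lr n lam x g * spike_lr n lam y g \<partial>goe_upper n \<partial>iid_pm1 n)"
      by (rule Fubini') measurable
  qed
  also have "\<dots> = (\<integral>\<^sup>+ x. \<integral>\<^sup>+ y. ennreal (exp (real n * lam\<^sup>2 * (\<Sum>i<n. x i * y i)\<^sup>2 / 2)) \<partial>iid_pm1 n \<partial>iid_pm1 n)"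
    unfolding spike_lr_def goe_upper_eq nn_integral_gauss_lr_mult[OF finite_upper goe_sd_pos] sum_spike_mult ..
  finally show ?thesis .
qed

lemma second_moment_spike_lr_le:
  assumes "0 \<le> lam" "lam < 1" "n > 0"
  shows "(\<integral>\<^sup>+ g. (\<integral>\<^sup>+ x. spike_lr n lam x g \<partial>iid_pm1 n)\<^sup>2 \<partial>goe_upper n) \<le> ennreal (1 / sqrt (1 - lam\<^sup>2))"
proof -
  interpret X: prob_space "iid_pm1 n" by (rule prob_space_iid_pm1)
  let ?N = "density lborel (normal_density 0 1)"
  interpret N: prob_space ?N by (rule prob_space_normal_density) simp
  interpret pair_sigma_finite "iid_pm1 n" ?N ..
  \<comment> \<open>Linearising the square with an auxiliary Gaussian \<open>t\<close> makes the integrand a product over coordinates.\<close>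
  let ?e = "\<lambda>t x y. ennreal (exp (\<Sum>i<n. (sqrt (real n) * lam * t * x i) * y i))"
  have trick: "ennreal (exp (real n * lam\<^sup>2 * (\<Sum>i<n. x i * y i)\<^sup>2 / 2)) = (\<integral>\<^sup>+ t. ?e t x y \<partial>?N)" for x y :: "nat \<Rightarrow> real"
  proof -
    have eq: "(\<Sum>i<n. (sqrt (real n) * lam * t * x i) * y i) = sqrt (real n) * lam * (\<Sum>i<n. x i * y i) * t" for t
      by (simp add: sum_distrib_left mult_ac)
    show ?thesis
      unfolding eq using nn_integral_normal_exp[of 1 "sqrt (real n) * lam * (\<Sum>i<n. x i * y i)"]
      by (simp add: power_mult_distrib)
  qed
  have "(\<integral>\<^sup>+ g. (\<integral>\<^sup>+ x. spike_lr n lam x g \<partial>iid_pm1 n)\<^sup>2 \<partial>goe_upper n)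
    = (\<integral>\<^sup>+ x. \<integral>\<^sup>+ y. \<integral>\<^sup>+ t. ?e t x y \<partial>?N \<partial>iid_pm1 n \<partial>iid_pm1 n)"
    unfolding nn_integral_spike_lr_square trick ..
  also have "\<dots> = (\<integral>\<^sup>+ x. \<integral>\<^sup>+ t. \<integral>\<^sup>+ y. ?e t x y \<partial>iid_pm1 n \<partial>?N \<partial>iid_pm1 n)"
    by (intro nn_integral_cong Fubini'[symmetric]) measurable
  also have "\<dots> \<le> (\<integral>\<^sup>+ x. \<integral>\<^sup>+ t. ennreal (exp (lam\<^sup>2 * t\<^sup>2 / 2 * (\<Sum>i<n. (x i)\<^sup>2))) \<partial>?N \<partial>iid_pm1 n)"
  \<comment> \<open>With \<open>x\<close> and \<open>t\<close> fixed the exponent is linear in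
    \<open>y\<close>, so the sub-Gaussian bound applies; the n from the squared coefficients cancels
    the 1/n from the prior.\<close>
  proof (intro nn_integral_mono)
    fix x :: "nat \<Rightarrow> real" and t :: real
    have eq: "(\<Sum>i<n. (sqrt (real n) * lam * t * x i)\<^sup>2) / (2 * real n) = lam\<^sup>2 * t\<^sup>2 / 2 * (\<Sum>i<n. (x i)\<^sup>2)"
      using \<open>n > 0\<close> by (simp add: power_mult_distrib sum_distrib_left sum_divide_distrib mult_ac)
    show "(\<integral>\<^sup>+ y. ?e t x y \<partial>iid_pm1 n) \<le> ennreal (exp (lam\<^sup>2 * t\<^sup>2 / 2 * (\<Sum>i<n. (x i)\<^sup>2)))"
      using nn_integral_iid_pm1_exp_le[where a = "\<lambda>i. sqrt (real n) * lam * t * x i" and n = n] unfolding eq .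
  qed
  also have "\<dots> = (\<integral>\<^sup>+ t. \<integral>\<^sup>+ x. ennreal (exp (lam\<^sup>2 * t\<^sup>2 / 2 * (\<Sum>i<n. (x i)\<^sup>2))) \<partial>iid_pm1 n \<partial>?N)"
    by (rule Fubini'[symmetric]) measurable
  also have "\<dots> = (\<integral>\<^sup>+ t. ennreal (exp (lam\<^sup>2 * t\<^sup>2 / 2)) \<partial>?N)"
  proof (rule nn_integral_cong)
    fix t :: real
    \<comment> \<open>Both atoms have square 1/n, so a spike drawn from the prior has unit norm. The
      product formula delivers this without an almost-everywhere argument.\<close>
    have "(\<integral>\<^sup>+ x. ennreal (exp (lam\<^sup>2 * t\<^sup>2 / 2 * (\<Sum>i<n. (x i)\<^sup>2))) \<partial>iid_pm1 n)
      = (\<integral>\<^sup>+ x. (\<Prod>i<n. ennreal (exp (lam\<^sup>2 * t\<^sup>2 / 2 * (x i)\<^sup>2))) \<partial>iid_pm1 n)"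
      by (simp add: exp_sum prod_ennreal sum_distrib_left)
    also have "\<dots> = (\<Prod>i<n. (ennreal (exp (lam\<^sup>2 * t\<^sup>2 / 2 * (1 / sqrt (real n))\<^sup>2)) + ennreal (exp (lam\<^sup>2 * t\<^sup>2 / 2 * (- 1 / sqrt (real n))\<^sup>2))) / 2)"
      by (rule nn_integral_iid_pm1_prod) measurable
    also have "\<dots> = (\<Prod>i<n. ennreal (exp (lam\<^sup>2 * t\<^sup>2 / 2 / real n)))"
      by (simp add: power_divide divide_ennreal flip: ennreal_plus ennreal_numeral)
    also have "\<dots> = ennreal (exp (lam\<^sup>2 * t\<^sup>2 / 2))"
      using \<open>n > 0\<close> by (simp add: ennreal_power flip: exp_of_nat_mult)
    finally show "(\<integral>\<^sup>+ x. ennreal (exp (lam\<^sup>2 * t\<^sup>2 / 2 * (\<Sum>i<n. (x i)\<^sup>2))) \<partial>iid_pm1 n) = ennreal (exp (lam\<^sup>2 * t\<^sup>2 / 2))" .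
  qed
  also have "\<dots> = ennreal (1 / sqrt (1 - lam\<^sup>2))"
    \<comment> \<open>The hypothesis lam < 1 enters here: the variance after the tilt is 1 / (1 -
      lam^2).\<close>
    using assms by (intro nn_integral_std_normal_exp_square) (simp add: power_less_one_iff abs_square_less_1)
  finally show ?thesis .
qed

section \<open>From the second moment bound to contiguity\<close>

lemma sets_GWig: "sets (GWig n lam X) = sets (mat_space n)"
  by (simp add: GWig_def)

text \<open>Cauchy-Schwarz for the likelihood ratio against the indicator of the event. The
  indicator is its own square, so the second factor is the null probability.\<close>

lemma measure_GWig_square_le:
  assumes "0 \<le> lam" "lam < 1" "n > 0" and A [measurable]: "A \<in> sets (mat_space n)"
  shows "(measure (GWig n lam iid_pm1) A)\<^sup>2 \<le> 1 / sqrt (1 - lam\<^sup>2) * measure (GWig_null n) A"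
proof -
  interpret X: prob_space "iid_pm1 n" by (rule prob_space_iid_pm1)
  interpret P: prob_space "GWig n lam iid_pm1"
    by (rule prob_space_GWig[OF prob_space_iid_pm1 sets_iid_pm1])
  interpret Q: prob_space "GWig_null n"
    unfolding GWig_null_def by (rule prob_space_GWig[OF prob_space_iid_pm1 sets_iid_pm1])
  have C: "1 / sqrt (1 - lam\<^sup>2) \<ge> 0"
    using assms by (simp add: abs_square_le_1)
  let ?i = "\<lambda>g. indicator A (symmetrize n g) :: ennreal"
  have sq: "(?i g)\<^sup>2 = ?i g" for g
    by (simp add: indicator_def)
  have "(emeasure (GWig n lam iid_pm1) A)\<^sup>2
    \<le> (\<integral>\<^sup>+ g. (\<integral>\<^sup>+ x. spike_lr n lam x g \<partial>iid_pm1 n)\<^sup>2 \<partial>goe_upper n) * (\<integral>\<^sup>+ g. (?i g)\<^sup>2 \<partial>goe_upper n)"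
    unfolding emeasure_GWig_density[OF A] by (rule Cauchy_Schwarz_nn_integral) measurable
  also have "\<dots> \<le> ennreal (1 / sqrt (1 - lam\<^sup>2)) * emeasure (GWig_null n) A"
    unfolding sq emeasure_GWig_null[OF A]
    by (intro mult_right_mono second_moment_spike_lr_le assms) simp
  finally show ?thesis
    using C by (simp add: P.emeasure_eq_measure Q.emeasure_eq_measure ennreal_power flip: ennreal_mult del: times_divide_eq_left)
qed

theorem theorem3p10:
  fixes lam :: real
  assumes "0 \<le> lam" and "lam < 1"
  shows "contiguous (\<lambda>n. GWig n lam iid_pm1) GWig_null"
  unfolding contiguous_def
proof (intro conjI allI impI)
  fix A assume A: "\<forall>n. A n \<in> sets (GWig_null n)" and lim: "(\<lambda>n. measure (GWig_null n) (A n)) \<longlonglongrightarrow> 0"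
  let ?p = "\<lambda>n. measure (GWig n lam iid_pm1) (A n)"
  have "(\<lambda>n. (?p n)\<^sup>2) \<longlonglongrightarrow> 0"
  proof (rule tendsto_sandwich[OF _ _ tendsto_const])
    show "\<forall>\<^sub>F n in sequentially. (?p n)\<^sup>2 \<le> 1 / sqrt (1 - lam\<^sup>2) * measure (GWig_null n) (A n)"
      \<comment> \<open>The quantitative bound is stated for positive dimension, hence it is applied
        eventually.\<close>
      using eventually_gt_at_top[of "0::nat"]
    proof eventually_elim
      case (elim n)
      then show ?case
        using A assms by (intro measure_GWig_square_le) (simp_all add: GWig_null_def sets_GWig)
    qed
    show "(\<lambda>n. 1 / sqrt (1 - lam\<^sup>2) * measure (GWig_null n) (A n)) \<longlonglongrightarrow> 0"
      using tendsto_mult_right_zero[OF lim] .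
  qed simp_all
  then show "?p \<longlonglongrightarrow> 0"
    \<comment> \<open>Probabilities are nonnegative, so the root of the square is the probability
      itself.\<close>
    using tendsto_real_sqrt[of "\<lambda>n. (?p n)\<^sup>2" 0] by simp
qed (simp_all add: GWig_null_def sets_GWig prob_space_GWig prob_space_iid_pm1 sets_iid_pm1)

end
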